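(* (Weak head normalization) If $M$ is a closed term, $A$ a type and $\Gamma$ a typing context such that $\Gamma\vdash M:A$, then $M$ has a value, i.e. there is a value $V$ with $M\twoheadrightarrow V$.
   Context: Terms. Fix a countable set $\mathcal{E}$ of exception names and a set of term variables. Terms, taken up to $\alpha$-equivalence, are generated by $$M,N ::= x \mid \lambda x.M \mid M\,N \mid \mathtt{raise}\,\varepsilon \mid \mathtt{try}\ M\ \mathtt{with}\ \varepsilon\mapsto N \mid 0 \mid S \mid \mathtt{rec} \mid \mathtt{nil} \mid \mathtt{cons} \mid \mathtt{fold}$$ with $\varepsilon\in\mathcal{E}$; application associates to the left, and $\mathtt{try}$ does not bind $\varepsilon$. Regular values are the closed terms of one of the forms $\lambda x.M$, $0$, $S$, $S\,N$, $\mathtt{rec}$, $\mathtt{rec}\,M$, $\mathtt{rec}\,M\,N$, $\mathtt{nil}$, $\mathtt{cons}$, $\mathtt{cons}\,M$, $\mathtt{cons}\,M\,N$, $\mathtt{fold}$, $\mathtt{fold}\,M$, $\mathtt{fold}\,M\,N$ (with $M,N$ arbitrary terms). Values are the regular values and the terms $\mathtt{raise}\,\varepsilon$. Reduction. The base rules are: (1) $(\lambda x.M)\,N \to M[x:=N]$; (2) $(\mathtt{raise}\,\varepsilon)\,M \to \mathtt{raise}\,\varepsilon$; (3) $\mathtt{try}\ (\mathtt{raise}\,\varepsilon)\ \mathtt{with}\ \varepsilon\mapsto N \to N$; (4) $\mathtt{try}\ (\mathtt{raise}\,\varepsilon')\ \mathtt{with}\ \varepsilon\mapsto N \to \mathtt{raise}\,\varepsilon'$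 if $\varepsilon\neq\varepsilon'$; (5) $\mathtt{try}\ V\ \mathtt{with}\ \varepsilon\mapsto N \to V$ if $V$ is a regular value; (6) $\mathtt{rec}\,X\,Y\,0 \to X$; $\mathtt{rec}\,X\,Y\,(S\,N)\to Y\,N\,(\mathtt{rec}\,X\,Y\,N)$; $\mathtt{rec}\,X\,Y\,(\mathtt{raise}\,\varepsilon)\to\mathtt{raise}\,\varepsilon$; (7) $\mathtt{fold}\,X\,Y\,\mathtt{nil}\to X$; $\mathtt{fold}\,X\,Y\,(\mathtt{cons}\,E\,L)\to Y\,E\,L\,(\mathtt{fold}\,X\,Y\,L)$; $\mathtt{fold}\,X\,Y\,(\mathtt{raise}\,\varepsilon)\to\mathtt{raise}\,\varepsilon$. The reduction $\to$ is the closure of these rules under all term constructors (under $\lambda$, on both sides of an application, in the body and in the handler of $\mathtt{try}$), and $\twoheadrightarrow$ is the reflexive transitive closure of $\to$. Types. $A,B ::= \alpha \mid \mathsf{nat} \mid \mathsf{list}\,A \mid A\to B \mid \forall\alpha.A \mid A\uplus\Delta \mid A^{\Delta}$, where $\alpha$ is a type variable and $\Delta\subseteq\mathcal{E}$ is a finite set of exception names; types are taken up to $\alpha$-equivalence. The constructions $A\uplus\Delta$ ("union") and $A^\Delta$ ("corruption") are purely syntactic and bind tighter than $\to$ and $\forall$; $FV$ denotes free type variables. A typing context $\Gamma$ is a finite set of declarations $x_i:A_i$ with distinct variables. Subtyping $\le$ is inductively defined by the following rules (for all types and finite $\Delta,\Delta'$; $A\equiv B$ abbreviates the two rules $A\le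 B$ and $B\le A$): $A\le A$; if $A\le B$ and $B\le C$ then $A\le C$; if $A'\le A$ and $B\le B'$ then $A\to B\le A'\to B'$; if $A\le B$ and $\alpha\notin FV(A)$ then $A\le\forall\alpha.B$; $\forall\alpha.A\le A[\alpha:=B]$; if $\alpha\notin FV(A)$ then $\forall\alpha.(A\to B)\le A\to\forall\alpha.B$; $A\le A\uplus\Delta$; $A\uplus\Delta\le A^\Delta$; $A^{\emptyset}\le A$; if $A\le B$ then $A\uplus\Delta\le B\uplus\Delta$; $(A\to B)\uplus\Delta\le A\to(B\uplus\Delta)$; $\forall\alpha.(A^\Delta)\le(\forall\alpha.A)^\Delta$; $\forall\alpha.(A\uplus\Delta)\le(\forall\alpha.A)\uplus\Delta$; $\mathsf{list}\,(A^\Delta)\le(\mathsf{list}\,A)^\Delta$; if $A\le B$ then $\mathsf{list}\,A\le\mathsf{list}\,B$; $(A\uplus\Delta)\uplus\Delta'\equiv A\uplus(\Delta\cup\Delta')$; $(A^\Delta)^{\Delta'}\equiv A^{\Delta\cup\Delta'}$; $(A\uplus\Delta)^{\Delta'}\equiv(A^{\Delta'})\uplus\Delta$; $(A\to B)^\Delta\equiv A^\Delta\to B^\Delta$. Typing $\Gamma\vdash M:A$ is inductively defined by: $\Gamma\vdash x:A$ if $(x:A)\in\Gamma$; if $\Gamma,x:A\vdash M:B$ then $\Gamma\vdash\lambda x.M:A\to B$; if $\Gamma\vdash M:A\to B$ and $\Gamma\vdash N:A$ then $\Gamma\vdash M\,N:B$; if $\Gamma\vdash M:A$ and $\alpha\notin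 FV(\Gamma)$ then $\Gamma\vdash M:\forall\alpha.A$; if $\Gamma\vdash M:A$ and $A\le B$ then $\Gamma\vdash M:B$; $\Gamma\vdash 0:\mathsf{nat}$; $\Gamma\vdash S:\mathsf{nat}\to\mathsf{nat}$; $\Gamma\vdash\mathtt{rec}:\forall\alpha.\,(\alpha\uplus\Delta)\to(\mathsf{nat}^\Delta\to\alpha\uplus\Delta\to\alpha\uplus\Delta)\to(\mathsf{nat}^\Delta)\uplus\Delta'\to\alpha\uplus(\Delta\cup\Delta')$ for all finite $\Delta,\Delta'$; $\Gamma\vdash\mathtt{nil}:\forall\alpha.\mathsf{list}\,\alpha$; $\Gamma\vdash\mathtt{cons}:\forall\alpha.\,\alpha\to\mathsf{list}\,\alpha\to\mathsf{list}\,\alpha$; $\Gamma\vdash\mathtt{fold}:\forall\alpha.\forall\beta.\,(\alpha\uplus\Delta)\to(\beta^\Delta\to(\mathsf{list}\,\beta)^\Delta\to\alpha\uplus\Delta\to\alpha\uplus\Delta)\to((\mathsf{list}\,\beta)^\Delta)\uplus\Delta'\to\alpha\uplus(\Delta\cup\Delta')$ for all finite $\Delta,\Delta'$; $\Gamma\vdash\mathtt{raise}\,\varepsilon:\forall\alpha.(\alpha\uplus\{\varepsilon\})$; if $\Gamma\vdash M:A\uplus\{\varepsilon\}$ and $\Gamma\vdash N:A$ then $\Gamma\vdash\mathtt{try}\ M\ \mathtt{with}\ \varepsilon\mapsto N:A$. *)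

theory Defs
  imports Main "HOL-Library.Countable" "HOL-Library.FSet"
begin

text \<open>
  Terms and types are taken up to \<open>\<alpha>\<close>-equivalence and are therefore represented with
  de Bruijn indices. The type parameter \<open>'e\<close> is the set of exception names.
\<close>

subsection \<open>Terms\<close>

datatype 'e tm =
    Var nat
  | Lam "'e tm"
  | App "'e tm" "'e tm"  (infixl "\<cdot>" 200)
  | Raise 'e
  | Try "'e tm" 'e "'e tm"  \<comment> \<open>\<open>Try M \<epsilon> N\<close> is \<open>try M with \<epsilon> \<mapsto> N\<close>; no term variable is bound\<close>
  | Zero
  | Succ
  | Rec
  | LNil
  | LCons
  | Fold

primrec lift_tm :: "nat \<Rightarrow> 'e tm \<Rightarrow> 'e tm" where
  "lift_tm k (Var i) = (if i < k then Var i else Var (Suc i))"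
| "lift_tm k (Lam M) = Lam (lift_tm (Suc k) M)"
| "lift_tm k (M \<cdot> N) = lift_tm k M \<cdot> lift_tm k N"
| "lift_tm k (Raise e) = Raise e"
| "lift_tm k (Try M e N) = Try (lift_tm k M) e (lift_tm k N)"
| "lift_tm k Zero = Zero"
| "lift_tm k Succ = Succ"
| "lift_tm k Rec = Rec"
| "lift_tm k LNil = LNil"
| "lift_tm k LCons = LCons"
| "lift_tm k Fold = Fold"

text \<open>
  \<open>subst_tm M N k\<close> substitutes \<open>N\<close> for index \<open>k\<close> in \<open>M\<close> and removes that index, decrementing
  the indices above it.
\<close>

primrec subst_tm :: "'e tm \<Rightarrow> 'e tm \<Rightarrow> nat \<Rightarrow> 'e tm" where
  "subst_tm (Var i) U k = (if k < i then Var (i - 1) else if i = k then U else Var i)"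
| "subst_tm (Lam M) U k = Lam (subst_tm M (lift_tm 0 U) (Suc k))"
| "subst_tm (M \<cdot> N) U k = subst_tm M U k \<cdot> subst_tm N U k"
| "subst_tm (Raise e) U k = Raise e"
| "subst_tm (Try M e N) U k = Try (subst_tm M U k) e (subst_tm N U k)"
| "subst_tm Zero U k = Zero"
| "subst_tm Succ U k = Succ"
| "subst_tm Rec U k = Rec"
| "subst_tm LNil U k = LNil"
| "subst_tm LCons U k = LCons"
| "subst_tm Fold U k = Fold"

primrec fv_tm :: "'e tm \<Rightarrow> nat set" where
  "fv_tm (Var i) = {i}"
| "fv_tm (Lam M) = {i. Suc i \<in> fv_tm M}"
| "fv_tm (M \<cdot> N) = fv_tm M \<union> fv_tm N"
| "fv_tm (Raise e) = {}"
| "fv_tm (Try M e N) = fv_tm M \<union> fv_tm N"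
| "fv_tm Zero = {}"
| "fv_tm Succ = {}"
| "fv_tm Rec = {}"
| "fv_tm LNil = {}"
| "fv_tm LCons = {}"
| "fv_tm Fold = {}"

definition closed_tm :: "'e tm \<Rightarrow> bool" where
  "closed_tm M \<longleftrightarrow> fv_tm M = {}"


subsection \<open>Values and reduction\<close>

inductive regular_form :: "'e tm \<Rightarrow> bool" where
  "regular_form (Lam M)"
| "regular_form Zero"
| "regular_form Succ"
| "regular_form (Succ \<cdot> N)"
| "regular_form Rec"
| "regular_form (Rec \<cdot> M)"
| "regular_form (Rec \<cdot> M \<cdot> N)"
| "regular_form LNil"
| "regular_form LCons"
| "regular_form (LCons \<cdot> M)"
| "regular_form (LCons \<cdot> M \<cdot> N)"
| "regular_form Fold"
| "regular_form (Fold \<cdot> M)"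
| "regular_form (Fold \<cdot> M \<cdot> N)"

definition regular_value :: "'e tm \<Rightarrow> bool" where
  "regular_value V \<longleftrightarrow> closed_tm V \<and> regular_form V"

definition is_value :: "'e tm \<Rightarrow> bool" where
  "is_value V \<longleftrightarrow> regular_value V \<or> (\<exists>e. V = Raise e)"

inductive base_red :: "'e tm \<Rightarrow> 'e tm \<Rightarrow> bool" where
  beta: "base_red (Lam M \<cdot> N) (subst_tm M N 0)"
| raise_app: "base_red (Raise e \<cdot> M) (Raise e)"
| try_catch: "base_red (Try (Raise e) e N) N"
| try_pass: "e \<noteq> e' \<Longrightarrow> base_red (Try (Raise e') e N) (Raise e')"
| try_value: "regular_value V \<Longrightarrow> base_red (Try V e N) V"
| rec_zero: "base_red (Rec \<cdot> X \<cdot> Y \<cdot> Zero) X"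
| rec_succ: "base_red (Rec \<cdot> X \<cdot> Y \<cdot> (Succ \<cdot> N)) (Y \<cdot> N \<cdot> (Rec \<cdot> X \<cdot> Y \<cdot> N))"
| rec_raise: "base_red (Rec \<cdot> X \<cdot> Y \<cdot> Raise e) (Raise e)"
| fold_nil: "base_red (Fold \<cdot> X \<cdot> Y \<cdot> LNil) X"
| fold_cons: "base_red (Fold \<cdot> X \<cdot> Y \<cdot> (LCons \<cdot> E \<cdot> L)) (Y \<cdot> E \<cdot> L \<cdot> (Fold \<cdot> X \<cdot> Y \<cdot> L))"
| fold_raise: "base_red (Fold \<cdot> X \<cdot> Y \<cdot> Raise e) (Raise e)"

inductive red :: "'e tm \<Rightarrow> 'e tm \<Rightarrow> bool"  (infix "\<rightarrow>\<^sub>r" 50) where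
  base: "base_red M N \<Longrightarrow> M \<rightarrow>\<^sub>r N"
| lam: "M \<rightarrow>\<^sub>r M' \<Longrightarrow> Lam M \<rightarrow>\<^sub>r Lam M'"
| app_left: "M \<rightarrow>\<^sub>r M' \<Longrightarrow> M \<cdot> N \<rightarrow>\<^sub>r M' \<cdot> N"
| app_right: "N \<rightarrow>\<^sub>r N' \<Longrightarrow> M \<cdot> N \<rightarrow>\<^sub>r M \<cdot> N'"
| try_body: "M \<rightarrow>\<^sub>r M' \<Longrightarrow> Try M e N \<rightarrow>\<^sub>r Try M' e N"
| try_handler: "N \<rightarrow>\<^sub>r N' \<Longrightarrow> Try M e N \<rightarrow>\<^sub>r Try M e N'"

abbreviation reds :: "'e tm \<Rightarrow> 'e tm \<Rightarrow> bool"  (infix "\<rightarrow>\<^sub>r\<^sup>*" 50) where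
  "M \<rightarrow>\<^sub>r\<^sup>* N \<equiv> red\<^sup>*\<^sup>* M N"


subsection \<open>Types\<close>

datatype 'e ty =
    TVar nat
  | TNat
  | TList "'e ty"
  | Arr "'e ty" "'e ty"  (infixr "\<rightarrow>\<^sub>t" 60)
  | All "'e ty"
  | Union "'e ty" "'e fset"  (infixl "\<uplus>\<^sub>t" 80)
  | Corr "'e ty" "'e fset"  (infixl "\<up>\<^sub>t" 80)  \<comment> \<open>corruption \<open>A\<^sup>\<Delta>\<close>\<close>

primrec lift_ty :: "nat \<Rightarrow> 'e ty \<Rightarrow> 'e ty" where
  "lift_ty k (TVar i) = (if i < k then TVar i else TVar (Suc i))"
| "lift_ty k TNat = TNat"
| "lift_ty k (TList A) = TList (lift_ty k A)"
| "lift_ty k (A \<rightarrow>\<^sub>t B) = lift_ty k A \<rightarrow>\<^sub>t lift_ty k B"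
| "lift_ty k (All A) = All (lift_ty (Suc k) A)"
| "lift_ty k (A \<uplus>\<^sub>t D) = lift_ty k A \<uplus>\<^sub>t D"
| "lift_ty k (A \<up>\<^sub>t D) = lift_ty k A \<up>\<^sub>t D"

primrec subst_ty :: "'e ty \<Rightarrow> 'e ty \<Rightarrow> nat \<Rightarrow> 'e ty" where
  "subst_ty (TVar i) U k = (if k < i then TVar (i - 1) else if i = k then U else TVar i)"
| "subst_ty TNat U k = TNat"
| "subst_ty (TList A) U k = TList (subst_ty A U k)"
| "subst_ty (A \<rightarrow>\<^sub>t B) U k = subst_ty A U k \<rightarrow>\<^sub>t subst_ty B U k"
| "subst_ty (All A) U k = All (subst_ty A (lift_ty 0 U) (Suc k))"
| "subst_ty (A \<uplus>\<^sub>t D) U k = subst_ty A U k \<uplus>\<^sub>t D"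
| "subst_ty (A \<up>\<^sub>t D) U k = subst_ty A U k \<up>\<^sub>t D"


subsection \<open>Subtyping\<close>

text \<open>
  A side condition \<open>\<alpha> \<notin> FV(A)\<close>, with \<open>\<alpha>\<close> the variable bound by the quantifier in the rule,
  is rendered by using \<open>lift_ty 0 A\<close> for \<open>A\<close> in the scope of \<open>\<alpha>\<close>.
\<close>

inductive subty :: "'e ty \<Rightarrow> 'e ty \<Rightarrow> bool"  (infix "\<sqsubseteq>\<^sub>t" 50) where
  refl: "A \<sqsubseteq>\<^sub>t A"
| trans: "A \<sqsubseteq>\<^sub>t B \<Longrightarrow> B \<sqsubseteq>\<^sub>t C \<Longrightarrow> A \<sqsubseteq>\<^sub>t C"
| arr: "A' \<sqsubseteq>\<^sub>t A \<Longrightarrow> B \<sqsubseteq>\<^sub>t B' \<Longrightarrow> A \<rightarrow>\<^sub>t B \<sqsubseteq>\<^sub>t A' \<rightarrow>\<^sub>t B'"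
| all_right: "lift_ty 0 A \<sqsubseteq>\<^sub>t B \<Longrightarrow> A \<sqsubseteq>\<^sub>t All B"
| all_inst: "All A \<sqsubseteq>\<^sub>t subst_ty A B 0"
| all_arr: "All (lift_ty 0 A \<rightarrow>\<^sub>t B) \<sqsubseteq>\<^sub>t A \<rightarrow>\<^sub>t All B"
| union_intro: "A \<sqsubseteq>\<^sub>t A \<uplus>\<^sub>t D"
| union_corr: "A \<uplus>\<^sub>t D \<sqsubseteq>\<^sub>t A \<up>\<^sub>t D"
| corr_empty: "A \<up>\<^sub>t {||} \<sqsubseteq>\<^sub>t A"
| union_mono: "A \<sqsubseteq>\<^sub>t B \<Longrightarrow> A \<uplus>\<^sub>t D \<sqsubseteq>\<^sub>t B \<uplus>\<^sub>t D"
| arr_union: "(A \<rightarrow>\<^sub>t B) \<uplus>\<^sub>t D \<sqsubseteq>\<^sub>t A \<rightarrow>\<^sub>t B \<uplus>\<^sub>t D"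
| all_corr: "All (A \<up>\<^sub>t D) \<sqsubseteq>\<^sub>t All A \<up>\<^sub>t D"
| all_union: "All (A \<uplus>\<^sub>t D) \<sqsubseteq>\<^sub>t All A \<uplus>\<^sub>t D"
| list_corr: "TList (A \<up>\<^sub>t D) \<sqsubseteq>\<^sub>t TList A \<up>\<^sub>t D"
| list_mono: "A \<sqsubseteq>\<^sub>t B \<Longrightarrow> TList A \<sqsubseteq>\<^sub>t TList B"
| union_union1: "A \<uplus>\<^sub>t D \<uplus>\<^sub>t D' \<sqsubseteq>\<^sub>t A \<uplus>\<^sub>t (D |\<union>| D')"
| union_union2: "A \<uplus>\<^sub>t (D |\<union>| D') \<sqsubseteq>\<^sub>t A \<uplus>\<^sub>t D \<uplus>\<^sub>t D'"
| corr_corr1: "A \<up>\<^sub>t D \<up>\<^sub>t D' \<sqsubseteq>\<^sub>t A \<up>\<^sub>t (D |\<union>| D')"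
| corr_corr2: "A \<up>\<^sub>t (D |\<union>| D') \<sqsubseteq>\<^sub>t A \<up>\<^sub>t D \<up>\<^sub>t D'"
| corr_union1: "A \<uplus>\<^sub>t D \<up>\<^sub>t D' \<sqsubseteq>\<^sub>t A \<up>\<^sub>t D' \<uplus>\<^sub>t D"
| corr_union2: "A \<up>\<^sub>t D' \<uplus>\<^sub>t D \<sqsubseteq>\<^sub>t A \<uplus>\<^sub>t D \<up>\<^sub>t D'"
| corr_arr1: "(A \<rightarrow>\<^sub>t B) \<up>\<^sub>t D \<sqsubseteq>\<^sub>t A \<up>\<^sub>t D \<rightarrow>\<^sub>t B \<up>\<^sub>t D"
| corr_arr2: "A \<up>\<^sub>t D \<rightarrow>\<^sub>t B \<up>\<^sub>t D \<sqsubseteq>\<^sub>t (A \<rightarrow>\<^sub>t B) \<up>\<^sub>t D"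


subsection \<open>Typing\<close>

text \<open>
  A context is a list of types: its entry at position \<open>i\<close> is the type declared for the free
  term variable with index \<open>i\<close>.
\<close>

definition rec_ty :: "'e fset \<Rightarrow> 'e fset \<Rightarrow> 'e ty" where
  "rec_ty D D' = All (
     TVar 0 \<uplus>\<^sub>t D
     \<rightarrow>\<^sub>t (TNat \<up>\<^sub>t D \<rightarrow>\<^sub>t TVar 0 \<uplus>\<^sub>t D \<rightarrow>\<^sub>t TVar 0 \<uplus>\<^sub>t D)
     \<rightarrow>\<^sub>t TNat \<up>\<^sub>t D \<uplus>\<^sub>t D'
     \<rightarrow>\<^sub>t TVar 0 \<uplus>\<^sub>t (D |\<union>| D'))"

text \<open>In \<open>\<forall>\<alpha>. \<forall>\<beta>. \<dots>\<close>, \<open>\<alpha>\<close> is index 1 and \<open>\<beta>\<close> is index 0.\<close>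

definition fold_ty :: "'e fset \<Rightarrow> 'e fset \<Rightarrow> 'e ty" where
  "fold_ty D D' = All (All (
     TVar 1 \<uplus>\<^sub>t D
     \<rightarrow>\<^sub>t (TVar 0 \<up>\<^sub>t D \<rightarrow>\<^sub>t TList (TVar 0) \<up>\<^sub>t D \<rightarrow>\<^sub>t TVar 1 \<uplus>\<^sub>t D \<rightarrow>\<^sub>t TVar 1 \<uplus>\<^sub>t D)
     \<rightarrow>\<^sub>t TList (TVar 0) \<up>\<^sub>t D \<uplus>\<^sub>t D'
     \<rightarrow>\<^sub>t TVar 1 \<uplus>\<^sub>t (D |\<union>| D')))"

inductive typing :: "'e ty list \<Rightarrow> 'e tm \<Rightarrow> 'e ty \<Rightarrow> bool"  ("_ \<turnstile> _ : _" [50, 50, 50] 50) where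
  var: "i < length \<Gamma> \<Longrightarrow> \<Gamma> ! i = A \<Longrightarrow> \<Gamma> \<turnstile> Var i : A"
| lam: "A # \<Gamma> \<turnstile> M : B \<Longrightarrow> \<Gamma> \<turnstile> Lam M : A \<rightarrow>\<^sub>t B"
| app: "\<Gamma> \<turnstile> M : A \<rightarrow>\<^sub>t B \<Longrightarrow> \<Gamma> \<turnstile> N : A \<Longrightarrow> \<Gamma> \<turnstile> M \<cdot> N : B"
| gen: "map (lift_ty 0) \<Gamma> \<turnstile> M : A \<Longrightarrow> \<Gamma> \<turnstile> M : All A"
| sub: "\<Gamma> \<turnstile> M : A \<Longrightarrow> A \<sqsubseteq>\<^sub>t B \<Longrightarrow> \<Gamma> \<turnstile> M : B"
| zero: "\<Gamma> \<turnstile> Zero : TNat"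
| succ: "\<Gamma> \<turnstile> Succ : TNat \<rightarrow>\<^sub>t TNat"
| rec: "\<Gamma> \<turnstile> Rec : rec_ty D D'"
| lnil: "\<Gamma> \<turnstile> LNil : All (TList (TVar 0))"
| lcons: "\<Gamma> \<turnstile> LCons : All (TVar 0 \<rightarrow>\<^sub>t TList (TVar 0) \<rightarrow>\<^sub>t TList (TVar 0))"
| lfold: "\<Gamma> \<turnstile> Fold : fold_ty D D'"
| raise_exn: "\<Gamma> \<turnstile> Raise e : All (TVar 0 \<uplus>\<^sub>t {|e|})"
| try_with: "\<Gamma> \<turnstile> M : A \<uplus>\<^sub>t {|e|} \<Longrightarrow> \<Gamma> \<turnstile> N : A \<Longrightarrow> \<Gamma> \<turnstile> Try M e N : A"

end

theory Submission imports Defs begin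

text \<open>
  The proof is by reducibility, with weak head reduction as evaluation strategy. A type is
  interpreted as a family of sets of normalizing terms indexed by the corruption level, a finite
  set \<open>D\<close> of exceptions: \<open>A\<^sup>\<Delta>\<close> at level \<open>D\<close> is \<open>A\<close> at level \<open>D \<union> \<Delta>\<close>, while \<open>A \<uplus> \<Delta>\<close> adds the
  terms evaluating to an exception of \<open>\<Delta>\<close> at the same level. Since \<open>A \<rightarrow> B\<close> has to be below
  \<open>A\<^sup>\<Delta> \<rightarrow> B\<^sup>\<Delta>\<close>, arrows are interpreted as in Kripke models: a function at level \<open>D\<close> acts at all
  levels above \<open>D\<close>. Quantifiers range over all monotone families of saturated sets whose
  level \<open>D\<close> contains the terms raising an exception of \<open>D\<close>.
\<close>

section \<open>Weak head reduction\<close>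

text \<open>
  The rule \<open>regular\<close> does not ask for a closed term, so that the model can be built from
  arbitrary terms; on closed terms weak head reduction is contained in the reduction.
\<close>

inductive whr :: "'e tm \<Rightarrow> 'e tm \<Rightarrow> bool"  (infix "\<rightarrow>\<^sub>w" 50) where
  base: "base_red M N \<Longrightarrow> M \<rightarrow>\<^sub>w N"
| regular: "regular_form V \<Longrightarrow> Try V e N \<rightarrow>\<^sub>w V"
| app: "M \<rightarrow>\<^sub>w M' \<Longrightarrow> M \<cdot> N \<rightarrow>\<^sub>w M' \<cdot> N"
| rec_arg: "N \<rightarrow>\<^sub>w N' \<Longrightarrow> Rec \<cdot> X \<cdot> Y \<cdot> N \<rightarrow>\<^sub>w Rec \<cdot> X \<cdot> Y \<cdot> N'"
| fold_arg: "N \<rightarrow>\<^sub>w N' \<Longrightarrow> Fold \<cdot> X \<cdot> Y \<cdot> N \<rightarrow>\<^sub>w Fold \<cdot> X \<cdot> Y \<cdot> N'"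
| try_body: "M \<rightarrow>\<^sub>w M' \<Longrightarrow> Try M e N \<rightarrow>\<^sub>w Try M' e N"

abbreviation whrs :: "'e tm \<Rightarrow> 'e tm \<Rightarrow> bool"  (infix "\<rightarrow>\<^sub>w\<^sup>*" 50) where
  "M \<rightarrow>\<^sub>w\<^sup>* N \<equiv> whr\<^sup>*\<^sup>* M N"

text \<open>Open counterpart of \<open>is_value\<close>: the two agree on closed terms.\<close>

definition whnf :: "'e tm \<Rightarrow> bool" where
  "whnf V \<longleftrightarrow> regular_form V \<or> (\<exists>e. V = Raise e)"

definition normalizing :: "'e tm set" where
  "normalizing = {M. \<exists>V. whnf V \<and> M \<rightarrow>\<^sub>w\<^sup>* V}"

definition raises :: "'e fset \<Rightarrow> 'e tm set" where
  "raises D = {M. \<exists>e. e |\<in>| D \<and> M \<rightarrow>\<^sub>w\<^sup>* Raise e}"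

section \<open>Determinism of weak head reduction\<close>

inductive_cases base_red_AppE: "base_red (M \<cdot> N) P"
inductive_cases base_red_TryE: "base_red (Try M e N) P"
inductive_cases whr_AppE: "M \<cdot> N \<rightarrow>\<^sub>w P"
inductive_cases whr_TryE: "Try M e N \<rightarrow>\<^sub>w P"

lemma whr_atomic [simp]:
  "\<not> Lam M \<rightarrow>\<^sub>w P" "\<not> Raise e \<rightarrow>\<^sub>w P" "\<not> Zero \<rightarrow>\<^sub>w P" "\<not> Succ \<rightarrow>\<^sub>w P" "\<not> Rec \<rightarrow>\<^sub>w P"
  "\<not> LNil \<rightarrow>\<^sub>w P" "\<not> LCons \<rightarrow>\<^sub>w P" "\<not> Fold \<rightarrow>\<^sub>w P"
  by (auto elim: whr.cases base_red.cases)

lemma whr_constr_app [simp]: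
  "\<not> Succ \<cdot> N \<rightarrow>\<^sub>w P" "\<not> Rec \<cdot> M \<rightarrow>\<^sub>w P" "\<not> Rec \<cdot> M \<cdot> N \<rightarrow>\<^sub>w P" "\<not> LCons \<cdot> M \<rightarrow>\<^sub>w P"
  "\<not> LCons \<cdot> M \<cdot> N \<rightarrow>\<^sub>w P" "\<not> Fold \<cdot> M \<rightarrow>\<^sub>w P" "\<not> Fold \<cdot> M \<cdot> N \<rightarrow>\<^sub>w P"
  by (auto elim!: whr_AppE base_red_AppE)

lemma whnf_not_whr: "whnf V \<Longrightarrow> \<not> V \<rightarrow>\<^sub>w P"
  by (auto simp: whnf_def elim: regular_form.cases)

lemma regular_form_not_whr: "regular_form V \<Longrightarrow> \<not> V \<rightarrow>\<^sub>w P"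
  by (simp add: whnf_not_whr whnf_def)

lemma regular_form_Raise [simp]: "\<not> regular_form (Raise e)"
  by (auto elim: regular_form.cases)

text \<open>The subterms of a redex that weak head reduction could enter are already weak head
  normal, so no congruence rule applies; \<open>try_value\<close> and \<open>regular\<close> overlap
  but agree.\<close>

lemma base_red_whr_unique: "base_red M P \<Longrightarrow> M \<rightarrow>\<^sub>w Q \<Longrightarrow> P = Q"
  by (induction rule: base_red.induct)
    (auto elim!: whr_AppE whr_TryE base_red_AppE base_red_TryE
      simp: regular_form_not_whr regular_value_def)

lemma whr_unique: "M \<rightarrow>\<^sub>w P \<Longrightarrow> M \<rightarrow>\<^sub>w Q \<Longrightarrow> P = Q"
proof (induction arbitrary: Q rule: whr.induct)
  case (base M N)
  then show ?case by (rule base_red_whr_unique)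
next
  case (regular V e N)
  from regular(2,1) show ?case
    by (auto elim!: whr_TryE base_red_TryE simp: regular_form_not_whr)
next
  case (app M M' N)
  from app(3) show ?case
  proof (rule whr_AppE)
    assume "base_red (M \<cdot> N) Q"
    from base_red_whr_unique[OF this whr.app[OF app(1)]] show ?thesis by simp
  next
    fix M'' assume "Q = M'' \<cdot> N" "M \<rightarrow>\<^sub>w M''"
    then show ?thesis using app.IH by simp
  \<comment> \<open>The other cases make \<open>M\<close> a partially applied \<open>Rec\<close> or
    \<open>Fold\<close>, which has no weak head step.\<close>
  qed (use app(1) in simp_all)
next
  case (rec_arg N N' X Y)
  from rec_arg(3) show ?case
  proof (rule whr_AppE)
    assume "base_red (Rec \<cdot> X \<cdot> Y \<cdot> N) Q"
    from base_red_whr_unique[OF this whr.rec_arg[OF rec_arg(1)]] show ?thesis by simp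
  next
    fix N'' X' Y' assume "Q = Rec \<cdot> X' \<cdot> Y' \<cdot> N''" "Rec \<cdot> X \<cdot> Y = Rec \<cdot> X' \<cdot> Y'" "N \<rightarrow>\<^sub>w N''"
    then show ?thesis using rec_arg.IH by simp
  qed simp_all
next
  case (fold_arg N N' X Y)
  from fold_arg(3) show ?case
  proof (rule whr_AppE)
    assume "base_red (Fold \<cdot> X \<cdot> Y \<cdot> N) Q"
    from base_red_whr_unique[OF this whr.fold_arg[OF fold_arg(1)]] show ?thesis by simp
  next
    fix N'' X' Y' assume "Q = Fold \<cdot> X' \<cdot> Y' \<cdot> N''" "Fold \<cdot> X \<cdot> Y = Fold \<cdot> X' \<cdot> Y'" "N \<rightarrow>\<^sub>w N''"
    then show ?thesis using fold_arg.IH by simp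
  qed simp_all
next
  case (try_body M M' e N)
  from try_body(3) show ?case
  proof (rule whr_TryE)
    assume "base_red (Try M e N) Q"
    from base_red_whr_unique[OF this whr.try_body[OF try_body(1)]] show ?thesis by simp
  next
    assume "regular_form M"
    then show ?thesis using try_body(1) regular_form_not_whr by blast
  next
    fix M'' assume "Q = Try M'' e N" "M \<rightarrow>\<^sub>w M''"
    then show ?thesis using try_body.IH by simp
  qed
qed

lemma whrs_lift:
  assumes "M \<rightarrow>\<^sub>w\<^sup>* M'" "\<And>P Q. P \<rightarrow>\<^sub>w Q \<Longrightarrow> f P \<rightarrow>\<^sub>w f Q"
  shows "f M \<rightarrow>\<^sub>w\<^sup>* f M'"
  using assms(1) by induction (auto intro: assms(2) rtranclp.rtrancl_into_rtrancl)

text \<open>\<open>V\<close> has no step, so a reduction from \<open>M\<close> to \<open>V\<close>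
  is not empty, and by determinism it starts with the step to \<open>M'\<close>.\<close>

lemma whr_whrs_whnf:
  assumes "whnf V" "M \<rightarrow>\<^sub>w M'"
  shows "M \<rightarrow>\<^sub>w\<^sup>* V \<longleftrightarrow> M' \<rightarrow>\<^sub>w\<^sup>* V"
  by (metis assms converse_rtranclpE converse_rtranclp_into_rtranclp whnf_not_whr whr_unique)

section \<open>Saturated sets and candidates\<close>

text \<open>Beyond the usual closure under expansion, closure under reduction serves to pass from
  the body of a \<open>Try\<close> to its weak head normal form.\<close>

definition saturated :: "'e tm set \<Rightarrow> bool" where
  "saturated X \<longleftrightarrow> X \<subseteq> normalizing \<and> (\<forall>M M'. M \<rightarrow>\<^sub>w M' \<longrightarrow> M \<in> X \<longleftrightarrow> M' \<in> X)"

lemma saturated_expand: "saturated X \<Longrightarrow> M \<rightarrow>\<^sub>w M' \<Longrightarrow> M' \<in> X \<Longrightarrow> M \<in> X"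
  unfolding saturated_def by blast

lemma saturated_iff:
  assumes "saturated X" "M \<rightarrow>\<^sub>w\<^sup>* M'"
  shows "M \<in> X \<longleftrightarrow> M' \<in> X"
  using assms(2) by induction (use assms(1) in \<open>auto simp: saturated_def\<close>)

lemma whnf_normalizing: "whnf V \<Longrightarrow> V \<in> normalizing"
  by (auto simp: normalizing_def)

lemma regular_normalizing: "regular_form V \<Longrightarrow> V \<in> normalizing"
  by (simp add: whnf_normalizing whnf_def)

lemma Raise_normalizing: "Raise e \<in> normalizing"
  by (simp add: whnf_normalizing whnf_def)

lemma saturated_normalizing: "saturated normalizing"
  by (auto simp: saturated_def normalizing_def whr_whrs_whnf)

lemmas normalizing_expand = saturated_expand[OF saturated_normalizing]

lemma saturated_raises: "saturated (raises D)"
proof -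
  have "whnf (Raise e)" for e :: 'a by (simp add: whnf_def)
  then show ?thesis
    by (auto simp: saturated_def raises_def normalizing_def whr_whrs_whnf)
qed

lemma saturated_Un: "saturated X \<Longrightarrow> saturated Y \<Longrightarrow> saturated (X \<union> Y)"
  by (auto simp: saturated_def)

lemma raises_mono: "D |\<subseteq>| D' \<Longrightarrow> raises D \<subseteq> raises D'"
  by (auto simp: raises_def)

lemma raises_union: "raises (D |\<union>| D') = raises D \<union> raises D'"
  by (auto simp: raises_def)

lemma Raise_in_raises: "e |\<in>| D \<Longrightarrow> Raise e \<in> raises D"
  by (auto simp: raises_def)

lemma raises_app: "M \<in> raises D \<Longrightarrow> M \<cdot> N \<in> raises D"
proof -
  assume "M \<in> raises D"
  then obtain e where e: "e |\<in>| D" "M \<rightarrow>\<^sub>w\<^sup>* Raise e"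
    by (auto simp: raises_def)
  have "M \<cdot> N \<rightarrow>\<^sub>w\<^sup>* Raise e \<cdot> N"
    using e(2) by (rule whrs_lift) (rule whr.app)
  also have "Raise e \<cdot> N \<rightarrow>\<^sub>w Raise e"
    by (intro whr.base base_red.raise_app)
  finally show ?thesis using e(1) by (auto simp: raises_def)
qed

text \<open>The last two conditions validate \<open>union_corr\<close>: they put level
  \<open>D\<close> and the exceptions of \<Delta> into level
  \<open>D |\<union>| \<Delta>\<close>.\<close>

definition cand :: "('e fset \<Rightarrow> 'e tm set) \<Rightarrow> bool" where
  "cand \<phi> \<longleftrightarrow> (\<forall>D. saturated (\<phi> D) \<and> raises D \<subseteq> \<phi> D) \<and> (\<forall>D D'. D |\<subseteq>| D' \<longrightarrow> \<phi> D \<subseteq> \<phi> D')"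

lemma cand_saturated: "cand \<phi> \<Longrightarrow> saturated (\<phi> D)"
  and cand_raises: "cand \<phi> \<Longrightarrow> raises D \<subseteq> \<phi> D"
  and cand_mono: "cand \<phi> \<Longrightarrow> D |\<subseteq>| D' \<Longrightarrow> \<phi> D \<subseteq> \<phi> D'"
  by (auto simp: cand_def)

text \<open>Shows that candidates exist, so that the intersection interpreting a quantifier stays
  within \<open>normalizing\<close>.\<close>

lemma cand_normalizing: "cand (\<lambda>D. normalizing)"
  using saturated_raises by (auto simp: cand_def saturated_normalizing, auto simp: saturated_def)

text \<open>\<open>Succ\<close> does not evaluate its argument, so exceptions of \<open>D\<close>
  may sit at any depth of a numeral. Being a least fixed point, the set supports the induction
  needed for \<open>Rec\<close>.\<close>

inductive_set nat_sem :: "'e fset \<Rightarrow> 'e tm set" for D where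
  zero: "Zero \<in> nat_sem D"
| succ: "N \<in> nat_sem D \<Longrightarrow> Succ \<cdot> N \<in> nat_sem D"
| raise_exn: "e |\<in>| D \<Longrightarrow> Raise e \<in> nat_sem D"
| expand: "M \<rightarrow>\<^sub>w M' \<Longrightarrow> M' \<in> nat_sem D \<Longrightarrow> M \<in> nat_sem D"

text \<open>Elements are taken from \<open>X\<close>, exceptions in the spine from \<open>D\<close>.
  They are separate because in the type \<open>TList (A \<up>\<^sub>t \<Delta>)\<close> they live at
  different levels.\<close>

inductive_set list_sem :: "'e tm set \<Rightarrow> 'e fset \<Rightarrow> 'e tm set" for X D where
  nil: "LNil \<in> list_sem X D"
| cons: "E \<in> X \<Longrightarrow> L \<in> list_sem X D \<Longrightarrow> LCons \<cdot> E \<cdot> L \<in> list_sem X D"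
| raise_exn: "e |\<in>| D \<Longrightarrow> Raise e \<in> list_sem X D"
| expand: "M \<rightarrow>\<^sub>w M' \<Longrightarrow> M' \<in> list_sem X D \<Longrightarrow> M \<in> list_sem X D"

lemma cand_nat_sem: "cand nat_sem"
  unfolding cand_def saturated_def
proof (intro allI conjI impI subsetI iffI)
  fix D :: "'a fset" and M M'
  assume "M \<in> nat_sem D" "M \<rightarrow>\<^sub>w M'"
  then show "M' \<in> nat_sem D"
    \<comment> \<open>Constructor forms and exceptions have no step, so only \<open>expand\<close>
      remains, and determinism identifies its reduct with \<open>M'\<close>.\<close>
    by (cases rule: nat_sem.cases) (auto dest: whr_unique)
next
  fix D :: "'a fset" and M
  assume "M \<in> nat_sem D"
  then show "M \<in> normalizing"
    by induction
      (auto intro: normalizing_expand Raise_normalizing regular_normalizing regular_form.intros)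
next
  fix D :: "'a fset" and M
  assume "M \<in> raises D"
  then obtain e where "e |\<in>| D" "M \<rightarrow>\<^sub>w\<^sup>* Raise e"
    by (auto simp: raises_def)
  from this(2,1) show "M \<in> nat_sem D"
    by (induction rule: converse_rtranclp_induct) (auto intro: nat_sem.intros)
next
  fix D D' :: "'a fset" and M
  assume "M \<in> nat_sem D" "D |\<subseteq>| D'"
  then show "M \<in> nat_sem D'"
    by induction (auto intro: nat_sem.intros)
qed (rule nat_sem.expand)

lemma list_sem_mono:
  assumes "X \<subseteq> X'" "D |\<subseteq>| D'"
  shows "list_sem X D \<subseteq> list_sem X' D'"
proof
  fix M assume "M \<in> list_sem X D"
  then show "M \<in> list_sem X' D'"
    by induction (use assms in \<open>auto intro: list_sem.intros\<close>)
qed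

lemma cand_list_sem:
  fixes \<phi> :: "'e fset \<Rightarrow> 'e tm set"
  assumes "cand \<phi>"
  shows "cand (\<lambda>D. list_sem (\<phi> D) D)"
  unfolding cand_def saturated_def
proof (intro allI conjI impI subsetI iffI)
  fix D :: "'e fset" and M M'
  assume "M \<in> list_sem (\<phi> D) D" "M \<rightarrow>\<^sub>w M'"
  then show "M' \<in> list_sem (\<phi> D) D"
    by (cases rule: list_sem.cases) (auto dest: whr_unique)
next
  fix D :: "'e fset" and M
  assume "M \<in> list_sem (\<phi> D) D"
  then show "M \<in> normalizing"
    by induction
      (auto intro: normalizing_expand Raise_normalizing regular_normalizing regular_form.intros)
next
  fix D :: "'e fset" and M
  assume "M \<in> raises D"
  then obtain e where "e |\<in>| D" "M \<rightarrow>\<^sub>w\<^sup>* Raise e"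
    by (auto simp: raises_def)
  from this(2,1) show "M \<in> list_sem (\<phi> D) D"
    by (induction rule: converse_rtranclp_induct) (auto intro: list_sem.intros)
next
  fix D D' :: "'e fset" and M
  assume "M \<in> list_sem (\<phi> D) D" "D |\<subseteq>| D'"
  then show "M \<in> list_sem (\<phi> D') D'"
    using list_sem_mono cand_mono[OF assms] by blast
qed (rule list_sem.expand)

text \<open>Demanding normalization of \<open>M\<close> outright avoids having to find an argument
  to apply it to.\<close>

definition arr_sem :: "('e fset \<Rightarrow> 'e tm set) \<Rightarrow> ('e fset \<Rightarrow> 'e tm set) \<Rightarrow> 'e fset \<Rightarrow> 'e tm set" where
  "arr_sem \<phi> \<psi> D =
    {M \<in> normalizing. \<forall>D'. D |\<subseteq>| D' \<longrightarrow> (\<forall>N \<in> \<phi> D'. M \<cdot> N \<in> \<psi> D')}"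

lemma arr_semI:
  assumes "M \<in> normalizing" "\<And>D' N. D |\<subseteq>| D' \<Longrightarrow> N \<in> \<phi> D' \<Longrightarrow> M \<cdot> N \<in> \<psi> D'"
  shows "M \<in> arr_sem \<phi> \<psi> D"
  using assms by (auto simp: arr_sem_def)

lemma arr_semD: "M \<in> arr_sem \<phi> \<psi> D \<Longrightarrow> D |\<subseteq>| D' \<Longrightarrow> N \<in> \<phi> D' \<Longrightarrow> M \<cdot> N \<in> \<psi> D'"
  by (auto simp: arr_sem_def)

text \<open>Monotonicity is built in, since a larger level leaves fewer levels above it. The rest
  comes from \<psi>, because a step or an exception in head position carries over to the
  application.\<close>

lemma cand_arr_sem:
  assumes "cand \<psi>"
  shows "cand (arr_sem \<phi> \<psi>)"
proof -
  have "M \<in> arr_sem \<phi> \<psi> D \<longleftrightarrow> M' \<in> arr_sem \<phi> \<psi> D" if "M \<rightarrow>\<^sub>w M'" for M M' D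
  proof -
    have "M \<in> normalizing \<longleftrightarrow> M' \<in> normalizing"
      using that saturated_normalizing by (auto simp: saturated_def)
    moreover have "M \<cdot> N \<in> \<psi> D' \<longleftrightarrow> M' \<cdot> N \<in> \<psi> D'" for N D'
      using cand_saturated[OF assms] whr.app[OF that] by (auto simp: saturated_def)
    ultimately show ?thesis by (simp add: arr_sem_def)
  qed
  moreover have "raises D \<subseteq> arr_sem \<phi> \<psi> D" for D
  proof (intro subsetI arr_semI)
    fix M assume M: "M \<in> raises D"
    then show "M \<in> normalizing"
      using saturated_raises by (auto simp: saturated_def)
    fix D' N assume "D |\<subseteq>| D'"
    then show "M \<cdot> N \<in> \<psi> D'"
      using raises_app[OF M] raises_mono cand_raises[OF assms] by blast
  qed
  ultimately show ?thesis
    by (auto simp: cand_def saturated_def arr_sem_def)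
qed

section \<open>Interpretation of types\<close>

primrec sem :: "'e ty \<Rightarrow> (nat \<Rightarrow> 'e fset \<Rightarrow> 'e tm set) \<Rightarrow> 'e fset \<Rightarrow> 'e tm set" where
  "sem (TVar i) \<rho> = \<rho> i"
| "sem TNat \<rho> = nat_sem"
| "sem (TList A) \<rho> = (\<lambda>D. list_sem (sem A \<rho> D) D)"
| "sem (A \<rightarrow>\<^sub>t B) \<rho> = arr_sem (sem A \<rho>) (sem B \<rho>)"
| "sem (All A) \<rho> = (\<lambda>D. \<Inter>\<phi> \<in> Collect cand. sem A (case_nat \<phi> \<rho>) D)"
| "sem (A \<uplus>\<^sub>t \<Delta>) \<rho> = (\<lambda>D. sem A \<rho> D \<union> raises \<Delta>)"
| "sem (A \<up>\<^sub>t \<Delta>) \<rho> = (\<lambda>D. sem A \<rho> (D |\<union>| \<Delta>))"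

definition cand_env :: "(nat \<Rightarrow> 'e fset \<Rightarrow> 'e tm set) \<Rightarrow> bool" where
  "cand_env \<rho> \<longleftrightarrow> (\<forall>i. cand (\<rho> i))"

lemma cand_env_case_nat: "cand \<phi> \<Longrightarrow> cand_env \<rho> \<Longrightarrow> cand_env (case_nat \<phi> \<rho>)"
  by (simp add: cand_env_def split: nat.split)

lemma cand_INT:
  assumes "I \<noteq> {}" "\<And>i. i \<in> I \<Longrightarrow> cand (f i)"
  shows "cand (\<lambda>D. \<Inter>i \<in> I. f i D)"
proof -
  have *: "saturated (f i D)" "raises D \<subseteq> f i D" "D |\<subseteq>| D' \<Longrightarrow> f i D \<subseteq> f i D'" if "i \<in> I" for i D D'
    using assms(2)[OF that] by (auto simp: cand_def)
  \<comment> \<open>Here \<open>I\<close> must be nonempty: an empty intersection would contain all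
    terms.\<close>
  have "(\<Inter>i \<in> I. f i D) \<subseteq> normalizing" for D
    using assms(1) *(1) by (fastforce simp: saturated_def)
  moreover have "M \<in> (\<Inter>i \<in> I. f i D) \<longleftrightarrow> M' \<in> (\<Inter>i \<in> I. f i D)" if "M \<rightarrow>\<^sub>w M'" for M M' D
    using *(1) that by (auto simp: saturated_def)
  moreover have "raises D \<subseteq> (\<Inter>i \<in> I. f i D)" for D
    using *(2) by blast
  moreover have "(\<Inter>i \<in> I. f i D) \<subseteq> (\<Inter>i \<in> I. f i D')" if "D |\<subseteq>| D'" for D D'
    using *(3)[OF _ that] by blast
  ultimately show ?thesis by (simp add: cand_def saturated_def)
qed

lemma cand_sem: "cand_env \<rho> \<Longrightarrow> cand (sem A \<rho>)"
proof (induction A arbitrary: \<rho>)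
  case (All A)
  then show ?case
    using cand_normalizing by (auto intro!: cand_INT cand_env_case_nat)
next
  case (Union A \<Delta>)
  then have "cand (sem A \<rho>)" by blast
  then show ?case
    by (simp add: cand_def saturated_Un saturated_raises) blast
next
  case (Corr A \<Delta>)
  then have c: "cand (sem A \<rho>)" by blast
  have "raises D \<subseteq> sem A \<rho> (D |\<union>| \<Delta>)" for D
    using cand_raises[OF c, of "D |\<union>| \<Delta>"] by (simp add: raises_union)
  moreover have "D |\<union>| \<Delta> |\<subseteq>| D' |\<union>| \<Delta>" if "D |\<subseteq>| D'" for D D'
    using that by auto
  ultimately show ?case using c unfolding cand_def by simp
qed (auto simp: cand_env_def cand_nat_sem cand_list_sem cand_arr_sem)

lemma sem_lift_ty:
  "sem (lift_ty k A) \<rho> = sem A (\<lambda>i. if i < k then \<rho> i else \<rho> (Suc i))"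
proof (induction A arbitrary: k \<rho>)
  case (All A)
  \<comment> \<open>Under the quantifier \<phi> occupies entry 0, so skipping entry
    \<open>Suc k\<close> of the extended environment means skipping entry \<open>k\<close> of
    \<rho>.\<close>
  have "(\<lambda>i. if i < Suc k then case_nat \<phi> \<rho> i else case_nat \<phi> \<rho> (Suc i)) =
      case_nat \<phi> (\<lambda>i. if i < k then \<rho> i else \<rho> (Suc i))" for \<phi>
    by (auto split: nat.split)
  then show ?case by (simp add: All)
qed auto

lemma sem_lift_ty_0 [simp]: "sem (lift_ty 0 A) (case_nat \<phi> \<rho>) = sem A \<rho>"
  by (simp add: sem_lift_ty)

lemma sem_subst_ty:
  "sem (subst_ty A U k) \<rho> =
    sem A (\<lambda>i. if i < k then \<rho> i else if i = k then sem U \<rho> else \<rho> (i - 1))"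
proof (induction A arbitrary: k U \<rho>)
  case (All A)
  have "(\<lambda>i. if i < Suc k then case_nat \<phi> \<rho> i
        else if i = Suc k then sem (lift_ty 0 U) (case_nat \<phi> \<rho>) else case_nat \<phi> \<rho> (i - 1)) =
      case_nat \<phi> (\<lambda>i. if i < k then \<rho> i else if i = k then sem U \<rho> else \<rho> (i - 1))"
    (is "?l = ?r") for \<phi>
  proof
    fix i
    \<comment> \<open>Index 0 is the bound variable; the inner split evaluates
      \<open>case_nat\<close> at \<open>i - 1\<close> in the branch above the substituted
      index.\<close>
    show "?l i = ?r i" by (cases i; cases "i - 1") auto
  qed
  then show ?case by (simp add: All)
qed auto

lemma sem_subst_ty_0: "sem (subst_ty A U 0) \<rho> = sem A (case_nat (sem U \<rho>) \<rho>)"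
proof -
  have "(\<lambda>i. if i < 0 then \<rho> i else if i = 0 then sem U \<rho> else \<rho> (i - 1)) = case_nat (sem U \<rho>) \<rho>"
    (is "?l = ?r")
  proof
    fix i
    show "?l i = ?r i" by (cases i) auto
  qed
  then show ?thesis by (simp only: sem_subst_ty)
qed

section \<open>Soundness of subtyping\<close>

lemma arr_sem_mono:
  assumes "\<And>D. \<phi>' D \<subseteq> \<phi> D" "\<And>D. \<psi> D \<subseteq> \<psi>' D"
  shows "arr_sem \<phi> \<psi> D \<subseteq> arr_sem \<phi>' \<psi>' D"
  unfolding arr_sem_def using assms by blast

text \<open>The levels \<open>D' |\<union>| \<Delta>\<close> with \<open>D'\<close> above
  \<open>D\<close> are exactly the levels above \<open>D |\<union>| \<Delta>\<close>. The Kripke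
  reading of arrows thus makes corruption distribute over them in both directions.\<close>

lemma arr_sem_corr:
  "arr_sem (\<lambda>D. \<phi> (D |\<union>| \<Delta>)) (\<lambda>D. \<psi> (D |\<union>| \<Delta>)) D = arr_sem \<phi> \<psi> (D |\<union>| \<Delta>)"
proof -
  have "(\<forall>D'. D |\<subseteq>| D' \<longrightarrow> P (D' |\<union>| \<Delta>)) \<longleftrightarrow> (\<forall>D'. D |\<union>| \<Delta> |\<subseteq>| D' \<longrightarrow> P D')" for P
  proof (intro iffI allI impI)
    fix D' assume P: "\<forall>D'. D |\<subseteq>| D' \<longrightarrow> P (D' |\<union>| \<Delta>)" and D': "D |\<union>| \<Delta> |\<subseteq>| D'"
    then have "P (D' |\<union>| \<Delta>)" by simp
    moreover have "D' |\<union>| \<Delta> = D'" using D' by auto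
    ultimately show "P D'" by simp
  next
    fix D' assume "\<forall>D'. D |\<union>| \<Delta> |\<subseteq>| D' \<longrightarrow> P D'" "D |\<subseteq>| D'"
    moreover from this(2) have "D |\<union>| \<Delta> |\<subseteq>| D' |\<union>| \<Delta>" by auto
    ultimately show "P (D' |\<union>| \<Delta>)" by blast
  qed
  note * = this[of "\<lambda>D. \<forall>N \<in> \<phi> D. M \<cdot> N \<in> \<psi> D" for M]
  show ?thesis
    unfolding arr_sem_def by (rule Collect_cong, rule conj_cong[OF HOL.refl], rule *)
qed

lemma subty_sound: "A \<sqsubseteq>\<^sub>t B \<Longrightarrow> cand_env \<rho> \<Longrightarrow> sem A \<rho> D \<subseteq> sem B \<rho> D"
proof (induction arbitrary: \<rho> D rule: subty.induct)
  case (trans A B C)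
  then show ?case by blast
next
  case (arr A' A B B')
  then show ?case by (simp add: arr_sem_mono)
next
  case (all_right A B)
  then show ?case
    using cand_env_case_nat by fastforce
next
  case (all_inst A B)
  then show ?case
    \<comment> \<open>The meaning of \<open>B\<close> is itself a candidate, hence one of the values
      of the quantified variable.\<close>
    using cand_sem[OF all_inst] by (auto simp: sem_subst_ty_0)
next
  case (all_arr A B)
  then show ?case
    \<comment> \<open>Normalization of the function is stated inside the intersection; extracting it
      takes one candidate.\<close>
    using cand_normalizing by (auto simp: arr_sem_def)
next
  case (union_corr A \<Delta>)
  note c = cand_sem[OF union_corr, of A]
  have "D |\<subseteq>| D |\<union>| \<Delta>" by auto
  then have "sem A \<rho> D \<subseteq> sem A \<rho> (D |\<union>| \<Delta>)" by (rule cand_mono[OF c])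
  moreover have "raises \<Delta> \<subseteq> sem A \<rho> (D |\<union>| \<Delta>)"
    using cand_raises[OF c, of "D |\<union>| \<Delta>"] by (simp add: raises_union)
  ultimately show ?case by simp
next
  case (arr_union A B \<Delta>)
  \<comment> \<open>A term that raises an exception still raises it when applied, so it acts as a
    function into the union.\<close>
  have "raises \<Delta> \<subseteq> arr_sem (sem A \<rho>) (sem (B \<uplus>\<^sub>t \<Delta>) \<rho>) D"
    using saturated_raises by (auto simp: saturated_def arr_sem_def raises_app)
  moreover have "sem (A \<rightarrow>\<^sub>t B) \<rho> D \<subseteq> arr_sem (sem A \<rho>) (sem (B \<uplus>\<^sub>t \<Delta>) \<rho>) D"
    by (simp add: arr_sem_mono)
  ultimately show ?case by simp
next
  case (list_corr A \<Delta>)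
  have "D |\<subseteq>| D |\<union>| \<Delta>" by auto
  then show ?case by (simp add: list_sem_mono)
next
  case (list_mono A B)
  then show ?case by (simp add: list_sem_mono)
next
  case (corr_arr1 A B \<Delta>)
  show ?case by (simp add: arr_sem_corr)
next
  case (corr_arr2 A \<Delta> B)
  show ?case by (simp add: arr_sem_corr)
\<comment> \<open>The remaining rules are set algebra on levels and \<open>raises\<close> sets; for
  \<open>all_union\<close>, \<open>raises \<Delta>\<close> does not depend on the quantified
  candidate.\<close>
qed (auto simp: raises_union ac_simps)

section \<open>Adequacy\<close>

definition up_subst :: "(nat \<Rightarrow> 'e tm) \<Rightarrow> nat \<Rightarrow> 'e tm" where
  "up_subst \<sigma> = case_nat (Var 0) (\<lambda>i. lift_tm 0 (\<sigma> i))"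

primrec psubst_tm :: "'e tm \<Rightarrow> (nat \<Rightarrow> 'e tm) \<Rightarrow> 'e tm" where
  "psubst_tm (Var i) \<sigma> = \<sigma> i"
| "psubst_tm (Lam M) \<sigma> = Lam (psubst_tm M (up_subst \<sigma>))"
| "psubst_tm (M \<cdot> N) \<sigma> = psubst_tm M \<sigma> \<cdot> psubst_tm N \<sigma>"
| "psubst_tm (Raise e) \<sigma> = Raise e"
| "psubst_tm (Try M e N) \<sigma> = Try (psubst_tm M \<sigma>) e (psubst_tm N \<sigma>)"
| "psubst_tm Zero \<sigma> = Zero"
| "psubst_tm Succ \<sigma> = Succ"
| "psubst_tm Rec \<sigma> = Rec"
| "psubst_tm LNil \<sigma> = LNil"
| "psubst_tm LCons \<sigma> = LCons"
| "psubst_tm Fold \<sigma> = Fold"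

lemma up_subst_Var: "up_subst Var = Var"
  by (auto simp: up_subst_def split: nat.split)

lemma psubst_tm_Var: "psubst_tm M Var = M"
  by (induction M) (auto simp: up_subst_Var)

lemma lift_lift_tm: "i \<le> k \<Longrightarrow> lift_tm (Suc k) (lift_tm i M) = lift_tm i (lift_tm k M)"
  by (induction M arbitrary: i k) auto

lemma subst_lift_tm: "i \<le> k \<Longrightarrow>
  subst_tm (lift_tm i M) (lift_tm i U) (Suc k) = lift_tm i (subst_tm M U k)"
  by (induction M arbitrary: i k U) (auto simp: lift_lift_tm[symmetric])

lemma subst_lift_tm_cancel: "subst_tm (lift_tm k M) U k = M"
  by (induction M arbitrary: k U) auto

lemma subst_psubst_tm: "subst_tm (psubst_tm M \<sigma>) U k = psubst_tm M (\<lambda>i. subst_tm (\<sigma> i) U k)"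
proof (induction M arbitrary: \<sigma> U k)
  case (Lam M)
  have "(\<lambda>i. subst_tm (up_subst \<sigma> i) (lift_tm 0 U) (Suc k)) = up_subst (\<lambda>i. subst_tm (\<sigma> i) U k)"
    by (auto simp: up_subst_def subst_lift_tm split: nat.split)
  then show ?case by (simp add: Lam)
qed auto

text \<open>Brings the contractum of a beta redex with substituted body into the form to which the
  induction hypothesis of adequacy applies.\<close>

lemma subst_psubst_up: "subst_tm (psubst_tm M (up_subst \<sigma>)) U 0 = psubst_tm M (case_nat U \<sigma>)"
proof -
  have "(\<lambda>i. subst_tm (up_subst \<sigma> i) U 0) = case_nat U \<sigma>"
    by (auto simp: up_subst_def subst_lift_tm_cancel split: nat.split)
  then show ?thesis by (simp add: subst_psubst_tm)
qed

section \<open>Recursors and handlers\<close>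

lemma saturated_base_red: "saturated X \<Longrightarrow> base_red M N \<Longrightarrow> N \<in> X \<Longrightarrow> M \<in> X"
  by (rule saturated_expand[OF _ whr.base])

text \<open>Each rule generating \<open>nat_sem\<close> matches one way \<open>Rec\<close> reduces,
  and saturation pulls the result back. The target \<open>X\<close> is not tied to the level
  \<open>D\<close> of the argument, which lets it be a union in \<open>rec_sem\<close>.\<close>

lemma rec_elim:
  assumes X: "saturated X" and raises: "raises D \<subseteq> X"
    and x: "x \<in> X" and y: "\<And>N R. N \<in> nat_sem D \<Longrightarrow> R \<in> X \<Longrightarrow> y \<cdot> N \<cdot> R \<in> X"
    and N: "N \<in> nat_sem D"
  shows "Rec \<cdot> x \<cdot> y \<cdot> N \<in> X"
  using N
proof induction
  case zero
  show ?case by (rule saturated_base_red[OF X base_red.rec_zero x])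
next
  case (succ N)
  show ?case by (rule saturated_base_red[OF X base_red.rec_succ y[OF succ]])
next
  case (raise_exn e)
  show ?case
    by (rule saturated_base_red[OF X base_red.rec_raise subsetD[OF raises Raise_in_raises[OF raise_exn]]])
next
  case (expand N N')
  show ?case by (rule saturated_expand[OF X whr.rec_arg[OF expand(1)] expand.IH])
qed

lemma fold_elim:
  assumes X: "saturated X" and raises: "raises D \<subseteq> X"
    and x: "x \<in> X"
    and y: "\<And>E L R. E \<in> Y \<Longrightarrow> L \<in> list_sem Y D \<Longrightarrow> R \<in> X \<Longrightarrow> y \<cdot> E \<cdot> L \<cdot> R \<in> X"
    and L: "L \<in> list_sem Y D"
  shows "Fold \<cdot> x \<cdot> y \<cdot> L \<in> X"
  using L
proof induction
  case nil
  show ?case by (rule saturated_base_red[OF X base_red.fold_nil x])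
next
  case (cons E L)
  show ?case by (rule saturated_base_red[OF X base_red.fold_cons y[OF cons]])
next
  case (raise_exn e)
  show ?case
    by (rule saturated_base_red[OF X base_red.fold_raise subsetD[OF raises Raise_in_raises[OF raise_exn]]])
next
  case (expand N N')
  show ?case by (rule saturated_expand[OF X whr.fold_arg[OF expand(1)] expand.IH])
qed

lemma rec_raises:
  assumes "N \<in> raises D"
  shows "Rec \<cdot> x \<cdot> y \<cdot> N \<in> raises D"
proof -
  obtain e where e: "e |\<in>| D" "N \<rightarrow>\<^sub>w\<^sup>* Raise e"
    using assms by (auto simp: raises_def)
  have "Rec \<cdot> x \<cdot> y \<cdot> N \<rightarrow>\<^sub>w\<^sup>* Rec \<cdot> x \<cdot> y \<cdot> Raise e"
    using e(2) by (rule whrs_lift) (rule whr.rec_arg)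
  also have "Rec \<cdot> x \<cdot> y \<cdot> Raise e \<rightarrow>\<^sub>w Raise e"
    by (intro whr.base base_red.rec_raise)
  finally show ?thesis using e(1) by (auto simp: raises_def)
qed

lemma fold_raises:
  assumes "L \<in> raises D"
  shows "Fold \<cdot> x \<cdot> y \<cdot> L \<in> raises D"
proof -
  obtain e where e: "e |\<in>| D" "L \<rightarrow>\<^sub>w\<^sup>* Raise e"
    using assms by (auto simp: raises_def)
  have "Fold \<cdot> x \<cdot> y \<cdot> L \<rightarrow>\<^sub>w\<^sup>* Fold \<cdot> x \<cdot> y \<cdot> Raise e"
    using e(2) by (rule whrs_lift) (rule whr.fold_arg)
  also have "Fold \<cdot> x \<cdot> y \<cdot> Raise e \<rightarrow>\<^sub>w Raise e"
    by (intro whr.base base_red.fold_raise)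
  finally show ?thesis using e(1) by (auto simp: raises_def)
qed

text \<open>A number corrupted by \<Delta> is handled by \<open>rec_elim\<close> with target
  \<open>\<phi> D3 \<union> raises \<Delta>\<close>; an argument raising an exception of \<Delta>'
  makes the whole term raise it.\<close>

lemma rec_sem: "Rec \<in> sem (rec_ty \<Delta> \<Delta>') \<rho> D"
  unfolding rec_ty_def sem.simps
proof (intro INT_I arr_semI)
  fix \<phi> :: "'a fset \<Rightarrow> 'a tm set" and D1 D2 D3 x y N
  \<comment> \<open>The nested arrows give rising levels, one for each argument.\<close>
  assume "\<phi> \<in> Collect cand" and D2: "D1 |\<subseteq>| D2" and D3: "D2 |\<subseteq>| D3"
    and x: "x \<in> case_nat \<phi> \<rho> 0 D1 \<union> raises \<Delta>"
    and y: "y \<in> arr_sem (\<lambda>D. nat_sem (D |\<union>| \<Delta>))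
          (arr_sem (\<lambda>D. case_nat \<phi> \<rho> 0 D \<union> raises \<Delta>) (\<lambda>D. case_nat \<phi> \<rho> 0 D \<union> raises \<Delta>)) D2"
    and N: "N \<in> nat_sem (D3 |\<union>| \<Delta>) \<union> raises \<Delta>'"
  then have \<phi>: "cand \<phi>" by simp
  have "Rec \<cdot> x \<cdot> y \<cdot> N \<in> \<phi> D3 \<union> raises \<Delta>" if "N \<in> nat_sem (D3 |\<union>| \<Delta>)"
    using _ _ _ _ that
  proof (rule rec_elim)
    show "saturated (\<phi> D3 \<union> raises \<Delta>)"
      by (intro saturated_Un cand_saturated[OF \<phi>] saturated_raises)
    show "raises (D3 |\<union>| \<Delta>) \<subseteq> \<phi> D3 \<union> raises \<Delta>"
      using cand_raises[OF \<phi>] by (auto simp: raises_union)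
    show "x \<in> \<phi> D3 \<union> raises \<Delta>"
      \<comment> \<open>\<open>x\<close> arrived at level \<open>D1\<close> and is carried up to
        \<open>D3\<close>.\<close>
      using x cand_mono[OF \<phi>] D2 D3 by (simp, blast)
    fix N R
    assume "N \<in> nat_sem (D3 |\<union>| \<Delta>)" "R \<in> \<phi> D3 \<union> raises \<Delta>"
    then show "y \<cdot> N \<cdot> R \<in> \<phi> D3 \<union> raises \<Delta>"
      \<comment> \<open>\<open>y\<close> arrived at level \<open>D2\<close>, but both of its
        arguments are supplied at \<open>D3\<close>.\<close>
      using arr_semD[OF arr_semD[OF y D3], of N D3 R] by simp
  qed
  then show "Rec \<cdot> x \<cdot> y \<cdot> N \<in> case_nat \<phi> \<rho> 0 D3 \<union> raises (\<Delta> |\<union>| \<Delta>')"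
    using N rec_raises by (auto simp: raises_union)
qed (auto intro: regular_normalizing regular_form.intros)

lemma fold_sem: "Fold \<in> sem (fold_ty \<Delta> \<Delta>') \<rho> D"
  unfolding fold_ty_def sem.simps
proof (intro INT_I arr_semI)
  fix \<phi> \<psi> :: "'a fset \<Rightarrow> 'a tm set" and D1 D2 D3 x y L
  \<comment> \<open>The inner quantifier is index 0: \<psi> interprets the element type and \<phi>
    the result type.\<close>
  let ?\<rho> = "case_nat \<psi> (case_nat \<phi> \<rho>)"
  assume "\<phi> \<in> Collect cand" and D2: "D1 |\<subseteq>| D2" and D3: "D2 |\<subseteq>| D3"
    and x: "x \<in> ?\<rho> 1 D1 \<union> raises \<Delta>"
    and y: "y \<in> arr_sem (\<lambda>D. ?\<rho> 0 (D |\<union>| \<Delta>))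
          (arr_sem (\<lambda>D. list_sem (?\<rho> 0 (D |\<union>| \<Delta>)) (D |\<union>| \<Delta>))
            (arr_sem (\<lambda>D. ?\<rho> 1 D \<union> raises \<Delta>) (\<lambda>D. ?\<rho> 1 D \<union> raises \<Delta>))) D2"
    and L: "L \<in> list_sem (?\<rho> 0 (D3 |\<union>| \<Delta>)) (D3 |\<union>| \<Delta>) \<union> raises \<Delta>'"
  then have \<phi>: "cand \<phi>" by simp
  have "Fold \<cdot> x \<cdot> y \<cdot> L \<in> \<phi> D3 \<union> raises \<Delta>" if "L \<in> list_sem (\<psi> (D3 |\<union>| \<Delta>)) (D3 |\<union>| \<Delta>)"
    using _ _ _ _ that
  proof (rule fold_elim)
    show "saturated (\<phi> D3 \<union> raises \<Delta>)"
      by (intro saturated_Un cand_saturated[OF \<phi>] saturated_raises)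
    show "raises (D3 |\<union>| \<Delta>) \<subseteq> \<phi> D3 \<union> raises \<Delta>"
      using cand_raises[OF \<phi>] by (auto simp: raises_union)
    show "x \<in> \<phi> D3 \<union> raises \<Delta>"
      using x cand_mono[OF \<phi>] D2 D3 by (simp, blast)
    fix E L R
    assume "E \<in> \<psi> (D3 |\<union>| \<Delta>)" "L \<in> list_sem (\<psi> (D3 |\<union>| \<Delta>)) (D3 |\<union>| \<Delta>)"
      "R \<in> \<phi> D3 \<union> raises \<Delta>"
    then show "y \<cdot> E \<cdot> L \<cdot> R \<in> \<phi> D3 \<union> raises \<Delta>"
      using arr_semD[OF arr_semD[OF arr_semD[OF y D3]], of E D3 L D3 R] by simp
  qed
  then show "Fold \<cdot> x \<cdot> y \<cdot> L \<in> ?\<rho> 1 D3 \<union> raises (\<Delta> |\<union>| \<Delta>')"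
    using L fold_raises by (auto simp: raises_union)
qed (auto intro: regular_normalizing regular_form.intros)

text \<open>Evaluate the body to \<open>V\<close>. If \<open>V\<close> is \<open>Raise e\<close>,
  the handler takes over; otherwise the \<open>Try\<close> reduces to \<open>V\<close>, which must
  then lie in \<open>X\<close>.\<close>

lemma try_sem:
  assumes X: "saturated X" and M: "M \<in> X \<union> raises {|e|}" and N: "N \<in> X"
  shows "Try M e N \<in> X"
proof -
  have "M \<in> normalizing"
    using X M saturated_raises by (auto simp: saturated_def)
  then obtain V where V: "whnf V" "M \<rightarrow>\<^sub>w\<^sup>* V"
    by (auto simp: normalizing_def)
  have step: "Try M e N \<rightarrow>\<^sub>w\<^sup>* Try V e N"
    using V(2) by (rule whrs_lift) (rule whr.try_body)
  have "Try V e N \<in> X"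
  proof (cases "V = Raise e")
    case True
    then show ?thesis
      using saturated_base_red[OF X base_red.try_catch N] by simp
  next
    case False
    have "V \<in> X \<union> raises {|e|}"
      using M V(2) saturated_iff saturated_Un[OF X saturated_raises] by blast
    \<comment> \<open>A weak head normal form reduces only to itself, so it reaches
      \<open>Raise e\<close> only by being it.\<close>
    moreover have "V \<notin> raises {|e|}"
      using False V(1) by (auto simp: raises_def elim: converse_rtranclpE dest: whnf_not_whr)
    ultimately have "V \<in> X" by blast
    moreover have "Try V e N \<rightarrow>\<^sub>w V"
      using False V(1) by (auto simp: whnf_def intro: whr.regular whr.base base_red.try_pass)
    ultimately show ?thesis using saturated_expand[OF X] by blast
  qed
  then show ?thesis using saturated_iff[OF X step] by blast
qed

text \<open>Only indices free in \<open>M\<close> constrain \<sigma>, so a closed term needs no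
  inhabitants of the types in its context. The level is generalized because a function body is used
  at higher levels.\<close>

theorem adequacy:
  assumes "\<Gamma> \<turnstile> M : A" "cand_env \<rho>"
    and "\<And>i. i \<in> fv_tm M \<Longrightarrow> i < length \<Gamma> \<Longrightarrow> \<sigma> i \<in> sem (\<Gamma> ! i) \<rho> D"
  shows "psubst_tm M \<sigma> \<in> sem A \<rho> D"
  using assms
proof (induction arbitrary: \<sigma> \<rho> D rule: typing.induct)
  case (lam A \<Gamma> M B)
  have "Lam (psubst_tm M (up_subst \<sigma>)) \<in> arr_sem (sem A \<rho>) (sem B \<rho>) D"
  proof (rule arr_semI)
    show "Lam (psubst_tm M (up_subst \<sigma>)) \<in> normalizing"
      by (intro regular_normalizing regular_form.intros)
    fix D' N assume D': "D |\<subseteq>| D'" and N: "N \<in> sem A \<rho> D'"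
    have "psubst_tm M (case_nat N \<sigma>) \<in> sem B \<rho> D'"
    proof (rule lam.IH)
      fix i assume i: "i \<in> fv_tm M" "i < length (A # \<Gamma>)"
      show "case_nat N \<sigma> i \<in> sem ((A # \<Gamma>) ! i) \<rho> D'"
        \<comment> \<open>Index 0 is the new argument; the older entries move from level
          \<open>D\<close> up to \<open>D'\<close> by monotonicity.\<close>
        using i N lam.prems(2) cand_mono[OF cand_sem[OF lam.prems(1)] D']
        by (cases i) fastforce+
    qed (rule lam.prems)
    then show "Lam (psubst_tm M (up_subst \<sigma>)) \<cdot> N \<in> sem B \<rho> D'"
      using saturated_base_red[OF cand_saturated[OF cand_sem[OF lam.prems(1)]] base_red.beta]
      by (metis subst_psubst_up)
  qed
  then show ?case by simp
next
  case (app \<Gamma> M A B N)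
  have "psubst_tm M \<sigma> \<in> sem (A \<rightarrow>\<^sub>t B) \<rho> D" "psubst_tm N \<sigma> \<in> sem A \<rho> D"
    using app by auto
  then show ?case by (auto intro: arr_semD)
next
  case (gen \<Gamma> M A)
  \<comment> \<open>The lifted context keeps its meaning for every choice of candidate
    (\<open>sem_lift_ty_0\<close>), so the hypothesis applies to each of them.\<close>
  then show ?case by (auto simp: cand_env_case_nat)
next
  case (sub \<Gamma> M A B)
  then show ?case using subty_sound by blast
next
  case (succ \<Gamma>)
  show ?case by (auto intro!: arr_semI regular_normalizing regular_form.intros nat_sem.succ)
next
  case (lcons \<Gamma>)
  show ?case
    \<comment> \<open>The head was supplied at a lower level than the tail and is moved up to the
      level of the tail.\<close>
    using cand_mono by (auto intro!: arr_semI regular_normalizing regular_form.intros list_sem.cons)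
next
  case (try_with \<Gamma> M A e N)
  have "psubst_tm M \<sigma> \<in> sem A \<rho> D \<union> raises {|e|}" "psubst_tm N \<sigma> \<in> sem A \<rho> D"
    using try_with.IH(1)[OF try_with.prems(1), of \<sigma> D] try_with.IH(2)[OF try_with.prems(1), of \<sigma> D]
      try_with.prems(2) by auto
  then show ?case
    using try_sem[OF cand_saturated[OF cand_sem[OF try_with.prems(1)]]] by simp
qed (auto simp: rec_sem fold_sem Raise_in_raises intro: nat_sem.intros list_sem.intros)

section \<open>Closed terms and the full reduction\<close>

lemma fv_Lam_bound: "{i. Suc i \<in> X} \<subseteq> {..<n} \<longleftrightarrow> X \<subseteq> {..<Suc n}"
proof
  assume X: "{i. Suc i \<in> X} \<subseteq> {..<n}"
  show "X \<subseteq> {..<Suc n}"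
  proof
    fix i assume "i \<in> X"
    then show "i \<in> {..<Suc n}" using X by (cases i) auto
  qed
qed auto

lemma fv_lift_tm_bound: "fv_tm M \<subseteq> {..<n} \<Longrightarrow> fv_tm (lift_tm k M) \<subseteq> {..<Suc n}"
  by (induction M arbitrary: k n) (simp_all add: fv_Lam_bound)

text \<open>Closedness is lost under binders, so an upper bound \<open>n\<close> on free indices
  replaces it in the induction; \<open>n = 0\<close> is the closed case.\<close>

lemma fv_subst_tm_bound:
  "fv_tm M \<subseteq> {..<Suc n} \<Longrightarrow> fv_tm U \<subseteq> {..<n} \<Longrightarrow> k \<le> n \<Longrightarrow> fv_tm (subst_tm M U k) \<subseteq> {..<n}"
  by (induction M arbitrary: U k n) (auto simp only: fv_tm.simps subst_tm.simps fv_Lam_bound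
    fv_lift_tm_bound Suc_le_mono Un_subset_iff empty_subsetI, auto split: if_splits)

lemma base_red_closed: "base_red M N \<Longrightarrow> closed_tm M \<Longrightarrow> closed_tm N"
proof (induction rule: base_red.induct)
  case (beta M N)
  then have "{i. Suc i \<in> fv_tm M} \<subseteq> {..<0}" "fv_tm N \<subseteq> {..<0}"
    by (simp_all add: closed_tm_def)
  then have "fv_tm (subst_tm M N 0) \<subseteq> {..<0}"
    by (intro fv_subst_tm_bound) (simp_all only: fv_Lam_bound)
  then show ?case by (simp add: closed_tm_def)
qed (auto simp: closed_tm_def)

text \<open>On a closed term the rule \<open>regular\<close> is an instance of
  \<open>try_value\<close>, and the other rules belong to the full reduction.\<close>

lemma whr_closed: "M \<rightarrow>\<^sub>w N \<Longrightarrow> closed_tm M \<Longrightarrow> M \<rightarrow>\<^sub>r N \<and> closed_tm N"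
proof (induction rule: whr.induct)
  case (base M N)
  then show ?case by (auto intro: red.base base_red_closed)
next
  case (regular V e N)
  then have "regular_value V" "closed_tm V"
    by (simp_all add: closed_tm_def regular_value_def)
  then show ?case by (simp add: red.base base_red.try_value)
qed (auto simp: closed_tm_def intro: red.intros)

lemma whrs_closed: "M \<rightarrow>\<^sub>w\<^sup>* N \<Longrightarrow> closed_tm M \<Longrightarrow> M \<rightarrow>\<^sub>r\<^sup>* N \<and> closed_tm N"
  by (induction rule: rtranclp_induct) (auto dest: whr_closed)

theorem theorem5p19:
  fixes M :: "'e::countable tm" and A :: "'e ty" and \<Gamma> :: "'e ty list"
  assumes "closed_tm M"
    and "\<Gamma> \<turnstile> M : A"
  shows "\<exists>V. is_value V \<and> M \<rightarrow>\<^sub>r\<^sup>* V"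
proof -
  \<comment> \<open>Free type variables may be read as any candidate; this is the simplest.\<close>
  define \<rho> :: "nat \<Rightarrow> 'e fset \<Rightarrow> 'e tm set" where "\<rho> = (\<lambda>i D. normalizing)"
  have \<rho>: "cand_env \<rho>"
    by (simp add: cand_env_def \<rho>_def cand_normalizing)
  \<comment> \<open>As \<open>M\<close> has no free variables, the identity substitution meets the
    condition of \<open>adequacy\<close> vacuously.\<close>
  have "psubst_tm M Var \<in> sem A \<rho> {||}"
    using assms by (intro adequacy[OF assms(2) \<rho>]) (simp add: closed_tm_def)
  then have "M \<in> normalizing"
    using cand_saturated[OF cand_sem[OF \<rho>]] by (auto simp: psubst_tm_Var saturated_def)
  then obtain V where "whnf V" "M \<rightarrow>\<^sub>w\<^sup>* V"
    by (auto simp: normalizing_def)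
  moreover from this(2) have "M \<rightarrow>\<^sub>r\<^sup>* V" "closed_tm V"
    using whrs_closed assms(1) by blast+
  ultimately show ?thesis
    by (auto simp: whnf_def is_value_def regular_value_def)
qed

end
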